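(* Let $\alpha$ be a positive integer and let $n\ge 0$ be an integer. Then the Dowling numbers $D_n(\alpha)=\sum_{k=0}^n W_\alpha(n,k)$ satisfy $$D_{n}(\alpha)=\sum_{j=0}^{n}(-1)^{n-j}\left[ \sum_{k=0}^{j}(-1)^jL^W_{j,k}(\alpha)\right] W_{\alpha}(n,j),$$ where $W_\alpha(n,j)$ are the Whitney numbers of the second kind and $L^W_{j,k}(\alpha)$ are the Whitney-Lah numbers.
   Context: The generalized factorial is $(x|\alpha)_k=\prod_{i=0}^{k-1}(x-i\alpha)$, with $(x|\alpha)_0=1$; thus $(x-1|\alpha)_k=\prod_{i=0}^{k-1}(x-1-i\alpha)$ and $(-x-1|\alpha)_k=\prod_{i=0}^{k-1}(-x-1-i\alpha)$. The Whitney numbers of the second kind $W_\alpha(n,k)$, $0\le k\le n$, are defined by the polynomial identity in $x$ $$x^n=\sum_{k=0}^{n}W_\alpha(n,k)(x-1|\alpha)_k .$$ The Dowling numbers are $D_n(\alpha)=\sum_{k=0}^n W_\alpha(n,k)$. The Whitney-Lah numbers $L^W_{n,k}(\alpha)$, $0\le k\le n$, are defined by the polynomial identity in $x$ $$(-x-1|\alpha)_n=\sum_{k=0}^{n}L^W_{n,k}(\alpha)(x-1|\alpha)_k$$ (equivalently, replacing $x$ by $-x$, $(x-1|\alpha)_n=\sum_{k=0}^{n}L^W_{n,k}(\alpha)(-x-1|\alpha)_k$). *)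

theory Defs
  imports "HOL-Computational_Algebra.Polynomial"
begin

definition gen_factorial :: "'a::comm_ring_1 \<Rightarrow> 'a \<Rightarrow> nat \<Rightarrow> 'a" where
  "gen_factorial x \<alpha> k = (\<Prod>i<k. x - of_nat i * \<alpha>)"

abbreviation poly_x :: "int poly" where
  "poly_x \<equiv> [:0, 1:]"

text \<open>
  The coefficients of \<open>p\<close> in the basis \<open>(x - 1 | \<alpha>)\<^sub>k\<close>, \<open>k \<le> n\<close>, of the polynomials of
  degree at most \<open>n\<close>, extended by zero beyond \<open>n\<close>. Since \<open>(x - 1 | \<alpha>)\<^sub>k\<close> is monic of degree \<open>k\<close>,
  they exist, are unique, and are integers; see \<open>ex1_is_expansion\<close> below.
\<close>

definition is_expansion :: "int \<Rightarrow> nat \<Rightarrow> int poly \<Rightarrow> (nat \<Rightarrow> int) \<Rightarrow> bool" where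
  "is_expansion \<alpha> n p c \<longleftrightarrow>
     p = (\<Sum>k=0..n. smult (c k) (gen_factorial (poly_x - 1) [:\<alpha>:] k)) \<and> (\<forall>k>n. c k = 0)"

definition whitney2 :: "int \<Rightarrow> nat \<Rightarrow> nat \<Rightarrow> int" where
  "whitney2 \<alpha> n = (THE c. is_expansion \<alpha> n (poly_x ^ n) c)"

definition whitney_lah :: "int \<Rightarrow> nat \<Rightarrow> nat \<Rightarrow> int" where
  "whitney_lah \<alpha> n = (THE c. is_expansion \<alpha> n (gen_factorial (- poly_x - 1) [:\<alpha>:] n) c)"

definition dowling :: "int \<Rightarrow> nat \<Rightarrow> int" where
  "dowling \<alpha> n = (\<Sum>k=0..n. whitney2 \<alpha> n k)"

lemma gen_factorial_monic:
  fixes \<alpha> :: int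
  shows "degree (gen_factorial (poly_x - 1) [:\<alpha>:] k) = k"
    and "coeff (gen_factorial (poly_x - 1) [:\<alpha>:] k) k = 1"
proof -
  have "degree (gen_factorial (poly_x - 1) [:\<alpha>:] k) = k \<and>
        lead_coeff (gen_factorial (poly_x - 1) [:\<alpha>:] k) = 1"
  proof (induction k)
    case 0
    then show ?case by (simp add: gen_factorial_def)
  next
    case (Suc k)
    define g where "g = gen_factorial (poly_x - 1) [:\<alpha>:] k"
    define l where "l = [:- 1 - int k * \<alpha>, 1:]"
    have g: "degree g = k" "lead_coeff g = 1"
      using Suc unfolding g_def by blast+
    have l: "degree l = 1" "lead_coeff l = 1" "l \<noteq> 0"
      by (simp_all add: l_def)
    have "g \<noteq> 0" using g(2) by auto
    have "poly_x - 1 - of_nat k * [:\<alpha>:] = l"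
      by (simp add: of_nat_poly one_pCons l_def)
    then have eq: "gen_factorial (poly_x - 1) [:\<alpha>:] (Suc k) = g * l"
      by (simp add: gen_factorial_def g_def)
    have "degree (g * l) = Suc k"
      using g l \<open>g \<noteq> 0\<close> by (simp add: degree_mult_eq)
    moreover have "lead_coeff (g * l) = 1"
      by (simp only: lead_coeff_mult g(2) l(2) mult_1)
    ultimately show ?case by (simp only: eq)
  qed
  then show "degree (gen_factorial (poly_x - 1) [:\<alpha>:] k) = k"
    and "coeff (gen_factorial (poly_x - 1) [:\<alpha>:] k) k = 1" by metis+
qed

lemma ex1_is_expansion:
  assumes "degree p \<le> n"
  shows "\<exists>!c. is_expansion \<alpha> n p c"
proof -
  define b where "b = gen_factorial (poly_x - 1) [:\<alpha>:]"
  have deg: "degree (b k) = k" and lead: "coeff (b k) k = 1" for k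
    unfolding b_def by (rule gen_factorial_monic)+
  have exp: "is_expansion \<alpha> m q c \<longleftrightarrow> q = (\<Sum>k=0..m. smult (c k) (b k)) \<and> (\<forall>k>m. c k = 0)"
    for m q c
    by (simp only: is_expansion_def b_def)
  have b0: "b 0 = 1"
    by (simp add: b_def gen_factorial_def)
  have top: "coeff (\<Sum>k=0..m. smult (c k) (b k)) m = c m" for c m
  proof -
    have "coeff (\<Sum>k=0..m. smult (c k) (b k)) m = (\<Sum>k=0..m. c k * coeff (b k) m)"
      by (simp add: coeff_sum)
    also have "\<dots> = (\<Sum>k=0..m. if k = m then c k else 0)"
      using deg lead by (intro sum.cong) (auto simp: coeff_eq_0)
    finally show ?thesis by simp
  qed
  show ?thesis using assms
  proof (induction n arbitrary: p)
    case 0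
    then obtain a where p: "p = [:a:]" by (metis degree_eq_zeroE le_zero_eq)
    show ?case
    proof (rule ex1I)
      show "is_expansion \<alpha> 0 p (\<lambda>k. if k = 0 then a else 0)"
        by (simp add: exp p b0)
    next
      fix d assume "is_expansion \<alpha> 0 p d"
      then have "[:a:] = [:d 0:]" and "\<forall>k>0. d k = 0"
        by (simp_all add: exp p b0)
      then show "d = (\<lambda>k. if k = 0 then a else 0)"
        by (auto simp: fun_eq_iff)
    qed
  next
    case (Suc n)
    define a where "a = coeff p (Suc n)"
    define q where "q = p - smult a (b (Suc n))"
    have "degree q \<le> n"
    proof (rule degree_le, intro allI impI)
      fix i assume "n < i"
      then consider "i = Suc n" | "i > Suc n" by linarith
      then show "coeff q i = 0"
        using lead[of "Suc n"] deg[of "Suc n"] Suc.prems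
        by cases (simp_all add: q_def a_def coeff_eq_0)
    qed
    then obtain c where c: "is_expansion \<alpha> n q c"
      and uniq: "\<And>d. is_expansion \<alpha> n q d \<Longrightarrow> d = c" using Suc.IH[of q] by blast
    have split: "(\<Sum>k=0..Suc n. smult (d k) (b k)) =
        (\<Sum>k=0..n. smult ((d(Suc n := z)) k) (b k)) + smult (d (Suc n)) (b (Suc n))" for d z
      by simp
    have "is_expansion \<alpha> (Suc n) p (c(Suc n := a))"
      unfolding exp
    proof
      have "c(Suc n := a, Suc n := 0) = c"
        using c by (auto simp: exp)
      then have "(\<Sum>k=0..Suc n. smult ((c(Suc n := a)) k) (b k)) = q + smult a (b (Suc n))"
        using c unfolding exp split[of "c(Suc n := a)" 0] by simp
      then show "p = (\<Sum>k=0..Suc n. smult ((c(Suc n := a)) k) (b k))"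
        by (simp only: q_def diff_add_cancel)
      show "\<forall>k>Suc n. (c(Suc n := a)) k = 0"
        using c by (simp add: exp)
    qed
    moreover have "d = c(Suc n := a)" if d: "is_expansion \<alpha> (Suc n) p d" for d
    proof -
      have p: "p = (\<Sum>k=0..Suc n. smult (d k) (b k))" and z: "\<forall>k>Suc n. d k = 0"
        using d unfolding exp by blast+
      have a: "a = d (Suc n)"
        unfolding a_def p by (rule top)
      have "q = (\<Sum>k=0..n. smult ((d(Suc n := 0)) k) (b k))"
        unfolding q_def p split[of d 0] a by (rule add_diff_cancel_right')
      moreover have "\<forall>k>n. (d(Suc n := 0)) k = 0"
        using z by auto
      ultimately have "is_expansion \<alpha> n q (d(Suc n := 0))"
        unfolding exp by blast
      then have "d(Suc n := 0) = c" by (rule uniq)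
      then show ?thesis using a by auto
    qed
    ultimately show ?case by (rule ex1I)
  qed
qed

lemma is_expansion_whitney2: "is_expansion \<alpha> n (poly_x ^ n) (whitney2 \<alpha> n)"
  unfolding whitney2_def
  by (rule theI'[OF ex1_is_expansion]) (simp add: degree_power_eq)

lemma is_expansion_whitney_lah:
  "is_expansion \<alpha> n (gen_factorial (- poly_x - 1) [:\<alpha>:] n) (whitney_lah \<alpha> n)"
  unfolding whitney_lah_def
proof (rule theI'[OF ex1_is_expansion])
  have "degree (\<Prod>i<n. - poly_x - 1 - of_nat i * [:\<alpha>:]) \<le> (\<Sum>i<n. degree (- poly_x - 1 - of_nat i * [:\<alpha>:]))"
    using degree_prod_sum_le[of "{..<n}" "\<lambda>i. - poly_x - 1 - of_nat i * [:\<alpha>:]"] by (simp add: o_def)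
  also have "\<dots> \<le> (\<Sum>i<n. 1)"
    by (intro sum_mono) (simp add: of_nat_poly one_pCons)
  finally show "degree (gen_factorial (- poly_x - 1) [:\<alpha>:] n) \<le> n"
    by (simp add: gen_factorial_def)
qed

end

theory Submission imports Defs begin

text \<open>
  Substituting \<open>-x\<close> for \<open>x\<close> in the expansion of \<open>x\<^sup>n\<close> turns \<open>(x - 1 | \<alpha>)\<^sub>j\<close> into \<open>(-x - 1 | \<alpha>)\<^sub>j\<close>;
  expanding the latter by the Whitney-Lah numbers and comparing coefficients gives
  \<open>W(n, k) = (-1)\<^sup>n \<Sum>\<^sub>j W(n, j) L(j, k)\<close>, which is then summed over \<open>k\<close>.
\<close>

lemma smult_sum_right: "smult a (\<Sum>i\<in>S. f i) = (\<Sum>i\<in>S. smult a (f i))"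
  by (induction S rule: infinite_finite_induct) (simp_all add: smult_add_right)

lemma pcompose_power: "pcompose (p ^ n) r = pcompose p r ^ n"
  by (induction n) (simp_all add: pcompose_1 pcompose_mult)

text \<open>Composition with \<open>r\<close> is a ring homomorphism fixing the constants
  \<open>of_nat i\<close>, so it acts on each factor through \<open>p\<close> and \<open>q\<close>
  alone.\<close>

lemma pcompose_gen_factorial:
  "pcompose (gen_factorial p q k) r = gen_factorial (pcompose p r) (pcompose q r) k"
  by (simp add: gen_factorial_def pcompose_prod pcompose_diff pcompose_mult pcompose_smult of_nat_poly)

text \<open>This is the extension by zero built into \<open>is_expansion\<close>; it allows sums
  over \<open>k\<close> to be lengthened from \<open>j\<close> to \<open>n\<close> and cut back
  again.\<close>

lemma whitney_lah_eq_0: "j < k \<Longrightarrow> whitney_lah \<alpha> j k = 0"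
  using is_expansion_whitney_lah[of \<alpha> j] by (simp add: is_expansion_def)

text \<open>The common upper limit \<open>n\<close> makes the range of \<open>k\<close> independent
  of \<open>j\<close>, so that the double sum over \<open>j\<close> and \<open>k\<close> can be
  interchanged.\<close>

lemma gen_factorial_neg_eq_sum_whitney_lah:
  assumes "j \<le> n"
  shows "gen_factorial (- poly_x - 1) [:\<alpha>:] j =
    (\<Sum>k=0..n. smult (whitney_lah \<alpha> j k) (gen_factorial (poly_x - 1) [:\<alpha>:] k))"
proof -
  have "gen_factorial (- poly_x - 1) [:\<alpha>:] j =
      (\<Sum>k=0..j. smult (whitney_lah \<alpha> j k) (gen_factorial (poly_x - 1) [:\<alpha>:] k))"
    using is_expansion_whitney_lah[of \<alpha> j] unfolding is_expansion_def by (rule conjunct1)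
  also have "\<dots> = (\<Sum>k=0..n. smult (whitney_lah \<alpha> j k) (gen_factorial (poly_x - 1) [:\<alpha>:] k))"
    using assms by (intro sum.mono_neutral_left) (auto simp: whitney_lah_eq_0)
  finally show ?thesis .
qed

lemma neg_poly_x_power_eq_sum_whitney2:
  "(- poly_x) ^ n = (\<Sum>j=0..n. smult (whitney2 \<alpha> n j) (gen_factorial (- poly_x - 1) [:\<alpha>:] j))"
proof -
  have "poly_x ^ n = (\<Sum>j=0..n. smult (whitney2 \<alpha> n j) (gen_factorial (poly_x - 1) [:\<alpha>:] j))"
    using is_expansion_whitney2[of \<alpha> n] unfolding is_expansion_def by (rule conjunct1)
  then have "pcompose (poly_x ^ n) (- poly_x) =
      pcompose (\<Sum>j=0..n. smult (whitney2 \<alpha> n j) (gen_factorial (poly_x - 1) [:\<alpha>:] j)) (- poly_x)"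
    by (rule arg_cong)
  \<comment> \<open>Since \<open>[:\<alpha>:]\<close> is constant, the substitution changes only the
    first argument of \<open>gen_factorial\<close>.\<close>
  moreover have "pcompose poly_x (- poly_x) = - poly_x" "pcompose (poly_x - 1) (- poly_x) = - poly_x - 1"
    by (simp_all add: pcompose_pCons pcompose_diff pcompose_1)
  ultimately show ?thesis
    by (simp only: pcompose_power pcompose_sum pcompose_smult pcompose_gen_factorial pcompose_const)
qed

text \<open>Both sides are the coefficients of \<open>poly_x ^ n\<close> in the same basis, and
  these are unique. The sign comes from \<open>(- poly_x) ^ n\<close>. No bound on \<open>k\<close>
  is imposed, as both sides vanish for \<open>k > n\<close>.\<close>

lemma whitney2_eq_sum_whitney_lah:
  "whitney2 \<alpha> n k = (-1) ^ n * (\<Sum>j=0..n. whitney2 \<alpha> n j * whitney_lah \<alpha> j k)"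
proof -
  define b where "b = gen_factorial (poly_x - 1) [:\<alpha>:]"
  define c where "c k = (-1) ^ n * (\<Sum>j=0..n. whitney2 \<alpha> n j * whitney_lah \<alpha> j k)" for k
  have "gen_factorial (- poly_x - 1) [:\<alpha>:] j = (\<Sum>k=0..n. smult (whitney_lah \<alpha> j k) (b k))"
    if "j \<in> {0..n}" for j
    using that unfolding b_def by (intro gen_factorial_neg_eq_sum_whitney_lah) simp
  then have "(- poly_x) ^ n = (\<Sum>j=0..n. smult (whitney2 \<alpha> n j) (\<Sum>k=0..n. smult (whitney_lah \<alpha> j k) (b k)))"
    unfolding neg_poly_x_power_eq_sum_whitney2[of n \<alpha>] by (intro sum.cong refl arg_cong2[where f = smult])
  also have "\<dots> = (\<Sum>k=0..n. smult (\<Sum>j=0..n. whitney2 \<alpha> n j * whitney_lah \<alpha> j k) (b k))"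
    by (simp only: smult_sum_right smult_smult smult_sum) (rule sum.swap)
  finally have "smult ((-1) ^ n) ((- poly_x) ^ n) = (\<Sum>k=0..n. smult (c k) (b k))"
    by (simp only: smult_sum_right smult_smult c_def)
  moreover have "smult ((-1) ^ n) ((- poly_x) ^ n) = poly_x ^ n"
    by (simp only: smult_power[symmetric] smult_minus_left smult_1_left minus_minus)
  \<comment> \<open>Uniqueness concerns whole functions on the naturals, so the tail counts:
    \<open>j \<le> n < k\<close> makes every Whitney-Lah number in \<open>c k\<close>
    vanish.\<close>
  moreover have "\<forall>k>n. c k = 0"
    by (simp add: c_def whitney_lah_eq_0)
  ultimately have "is_expansion \<alpha> n (poly_x ^ n) c"
    by (simp only: is_expansion_def b_def simp_thms)
  moreover have "\<exists>!c. is_expansion \<alpha> n (poly_x ^ n) c"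
    by (rule ex1_is_expansion) (simp add: degree_power_eq)
  ultimately have "whitney2 \<alpha> n = c"
    using is_expansion_whitney2[of \<alpha> n] by blast
  then have "whitney2 \<alpha> n k = c k" by (rule fun_cong)
  then show ?thesis unfolding c_def .
qed

theorem theorem3p2:
  fixes \<alpha> :: int and n :: nat
  assumes "\<alpha> > 0"
  shows "dowling \<alpha> n =
    (\<Sum>j=0..n. (-1) ^ (n - j) * (\<Sum>k=0..j. (-1) ^ j * whitney_lah \<alpha> j k) * whitney2 \<alpha> n j)"
proof -
  have "dowling \<alpha> n = (\<Sum>k=0..n. (-1) ^ n * (\<Sum>j=0..n. whitney2 \<alpha> n j * whitney_lah \<alpha> j k))"
    unfolding dowling_def by (rule sum.cong[OF refl whitney2_eq_sum_whitney_lah])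
  also have "\<dots> = (\<Sum>j=0..n. (-1) ^ n * whitney2 \<alpha> n j * (\<Sum>k=0..n. whitney_lah \<alpha> j k))"
    by (simp only: sum_distrib_left mult.assoc) (rule sum.swap)
  also have "\<dots> = (\<Sum>j=0..n. (-1) ^ (n - j) * (\<Sum>k=0..j. (-1) ^ j * whitney_lah \<alpha> j k) * whitney2 \<alpha> n j)"
  proof (rule sum.cong[OF refl])
    fix j assume "j \<in> {0..n}"
    then have "j \<le> n" by simp
    \<comment> \<open>The two signs in the claimed formula combine to one independent of
      \<open>j\<close>; \<open>j \<le> n\<close> keeps the subtraction from truncating.\<close>
    then have sign: "(-1 :: int) ^ n = (-1) ^ (n - j) * (-1) ^ j"
      by (simp flip: power_add)
    have "(\<Sum>k=0..n. whitney_lah \<alpha> j k) = (\<Sum>k=0..j. whitney_lah \<alpha> j k)"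
      using \<open>j \<le> n\<close> by (intro sum.mono_neutral_right) (auto simp: whitney_lah_eq_0)
    then show "(-1) ^ n * whitney2 \<alpha> n j * (\<Sum>k=0..n. whitney_lah \<alpha> j k) =
        (-1) ^ (n - j) * (\<Sum>k=0..j. (-1) ^ j * whitney_lah \<alpha> j k) * whitney2 \<alpha> n j"
      by (simp only: sign flip: sum_distrib_left) (simp only: mult_ac)
  qed
  finally show ?thesis .
qed

end
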